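(* Thomas division, Janet division and Pommaret division on the set $\mathbb{M}$ of monomials in $x_1,\dots,x_n$ are involutive divisions. That is, for each of these three rules, if for every finite $U\subset\mathbb{M}$ and every $u\in U$ one lets $L(u,U)$ be the set of all monomials in the variables that are multiplicative for $u$ (with respect to $U$), then the family $L(u,U)$ is an involutive division on $\mathbb{M}$.
   Context: $K$ is a field of characteristic zero, $\mathbb{M}$ is the set (monoid) of monomials $x_1^{d_1}\cdots x_n^{d_n}$, $d_i\ge 0$, in $K[x_1,\dots,x_n]$, and $\deg_i(u)$ is the degree of $x_i$ in the monomial $u$. Involutive division: an involutive division $L$ on $\mathbb{M}$ is given if for any finite $U\subset\mathbb{M}$ and any $u\in U$ there is given a submonoid $L(u,U)$ of $\mathbb{M}$ such that (a) if $w\in L(u,U)$ and $v\mid w$, then $v\in L(u,U)$; (b) if $u,v\in U$ and $uL(u,U)\cap vL(v,U)\neq\emptyset$, then $u\in vL(v,U)$ or $v\in uL(u,U)$; (c) if $v\in U$ and $v\in uL(u,U)$, then $L(v,U)\subseteq L(u,U)$; (d) if $V\subseteq U$, then $L(u,U)\subseteq L(u,V)$ for all $u\in V$. Thomas division: for finite $U$ let $h_i(U)=\max\{\deg_i(u)\mid u\in U\}$. The variable $x_i$ is multiplicative for $u\in U$ if $\deg_i(u)=h_i(U)$ and non-multiplicative otherwise. Janet division: for finite $U$, $1\le i\le n$ and non-negative integers $d_1,\dots,d_i$ let $[d_1,\dots,d_i]=\{u\in U\mid \deg_j(u)=d_j,\ 1\le j\le i\}$. The variable $x_i$ is multiplicative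 for $u\in U$ if $i=1$ and $\deg_1(u)=\max\{\deg_1(v)\mid v\in U\}$, or if $i>1$, $u\in[d_1,\dots,d_{i-1}]$ and $\deg_i(u)=\max\{\deg_i(v)\mid v\in[d_1,\dots,d_{i-1}]\}$; otherwise it is non-multiplicative. Pommaret division: for a monomial $u=x_1^{d_1}\cdots x_k^{d_k}$ with $d_k>0$ the variables $x_j$ with $j\ge k$ are multiplicative and those with $j<k$ are non-multiplicative; for $u=1$ all variables are multiplicative (independently of $U$). *)

theory Defs
  imports "HOL-Algebra.Divisibility" "HOL-Algebra.Coset" "HOL-Library.Poly_Mapping"
begin

text \<open>The monomial \<open>x\<^sub>1\<^sup>d\<^sup>1 \<cdots> x\<^sub>n\<^sup>d\<^sup>n\<close> is represented by its exponent function: the finitely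
  supported map sending \<open>i\<close> to the exponent of the \<open>i\<close>-th variable. Hence the product of
  monomials is the pointwise sum and the monomial \<open>1\<close> is the zero map. Variables are numbered
  from \<open>1\<close> to \<open>n\<close>. The coefficient field plays no role.\<close>

type_synonym monomial = "nat \<Rightarrow>\<^sub>0 nat"

abbreviation deg :: "nat \<Rightarrow> monomial \<Rightarrow> nat"
  where "deg i u \<equiv> Poly_Mapping.lookup u i"

abbreviation vars :: "monomial \<Rightarrow> nat set"
  where "vars u \<equiv> Poly_Mapping.keys u"

definition monomials :: "nat \<Rightarrow> monomial monoid"
  where "monomials n = \<lparr>carrier = {u. vars u \<subseteq> {1..n}}, mult = (+), one = 0\<rparr>"

lemma comm_monoid_monomials: "comm_monoid (monomials n)"
proof (rule comm_monoidI)
  fix x y assume "x \<in> carrier (monomials n)" "y \<in> carrier (monomials n)"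
  then show "x \<otimes>\<^bsub>monomials n\<^esub> y \<in> carrier (monomials n)"
    using Poly_Mapping.keys_add[of x y] unfolding monomials_def by auto
qed (simp_all add: monomials_def ac_simps)

text \<open>\<open>L u U\<close> is only constrained for finite sets \<open>U\<close> of monomials and \<open>u \<in> U\<close>. The set
  \<open>u L(u,U)\<close> is the left coset \<open>u <# L u U\<close> in the monoid of monomials.\<close>

locale involutive_division =
  fixes n :: nat and L :: "monomial \<Rightarrow> monomial set \<Rightarrow> monomial set"
  assumes submonoid:
    "\<lbrakk>finite U; U \<subseteq> carrier (monomials n); u \<in> U\<rbrakk> \<Longrightarrow> submonoid (L u U) (monomials n)"
  and divisor_closed:
    "\<lbrakk>finite U; U \<subseteq> carrier (monomials n); u \<in> U;
      w \<in> L u U; v \<in> carrier (monomials n); v divides\<^bsub>monomials n\<^esub> w\<rbrakk> \<Longrightarrow> v \<in> L u U"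
  and intersecting_cones:
    "\<lbrakk>finite U; U \<subseteq> carrier (monomials n); u \<in> U; v \<in> U;
      (u <#\<^bsub>monomials n\<^esub> L u U) \<inter> (v <#\<^bsub>monomials n\<^esub> L v U) \<noteq> {}\<rbrakk>
     \<Longrightarrow> u \<in> v <#\<^bsub>monomials n\<^esub> L v U \<or> v \<in> u <#\<^bsub>monomials n\<^esub> L u U"
  and nested_cones:
    "\<lbrakk>finite U; U \<subseteq> carrier (monomials n); u \<in> U; v \<in> U;
      v \<in> u <#\<^bsub>monomials n\<^esub> L u U\<rbrakk> \<Longrightarrow> L v U \<subseteq> L u U"
  and antimono:
    "\<lbrakk>finite U; U \<subseteq> carrier (monomials n); V \<subseteq> U; u \<in> V\<rbrakk> \<Longrightarrow> L u U \<subseteq> L u V"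

text \<open>A rule \<open>is_mult\<close> declares which variables \<open>i\<close> are multiplicative for \<open>u\<close> with respect to
  \<open>U\<close>.\<close>

definition division_of ::
    "nat \<Rightarrow> (nat \<Rightarrow> monomial \<Rightarrow> monomial set \<Rightarrow> bool) \<Rightarrow> monomial \<Rightarrow> monomial set \<Rightarrow> monomial set"
  where "division_of n is_mult u U =
    {w \<in> carrier (monomials n). \<forall>i\<in>vars w. is_mult i u U}"

definition max_deg :: "nat \<Rightarrow> monomial set \<Rightarrow> nat"
  where "max_deg i U = Max (deg i ` U)"

definition thomas_mult :: "nat \<Rightarrow> monomial \<Rightarrow> monomial set \<Rightarrow> bool"
  where "thomas_mult i u U \<longleftrightarrow> deg i u = max_deg i U"

text \<open>The class \<open>[d\<^sub>1, \<dots>, d\<^sub>i]\<close> of \<open>U\<close>; only the values of \<open>d\<close> on \<open>{1..i}\<close> matter.\<close>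

definition janet_class :: "monomial set \<Rightarrow> (nat \<Rightarrow> nat) \<Rightarrow> nat \<Rightarrow> monomial set"
  where "janet_class U d i = {u \<in> U. \<forall>j\<in>{1..i}. deg j u = d j}"

definition janet_mult :: "nat \<Rightarrow> monomial \<Rightarrow> monomial set \<Rightarrow> bool"
  where "janet_mult i u U \<longleftrightarrow>
    i = 1 \<and> deg 1 u = max_deg 1 U \<or>
    i > 1 \<and> (\<exists>d. u \<in> janet_class U d (i - 1) \<and> deg i u = max_deg i (janet_class U d (i - 1)))"

text \<open>For \<open>u \<noteq> 1\<close>, the last variable with positive exponent has index \<open>Max (vars u)\<close>.
  The set \<open>U\<close> is ignored.\<close>

definition pommaret_mult :: "nat \<Rightarrow> monomial \<Rightarrow> monomial set \<Rightarrow> bool"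
  where "pommaret_mult j u U \<longleftrightarrow> u = 0 \<or> Max (vars u) \<le> j"

end

theory Submission
  imports Defs
begin

text \<open>
  Write \<open>u L(u,U)\<close> for the cone of \<open>u\<close>. A monomial \<open>x\<close> lies in this cone iff \<open>u\<close> divides \<open>x\<close> and
  every variable in which \<open>x\<close> has strictly larger degree is multiplicative for \<open>u\<close>
  (\<open>mem_cone_iff\<close>); this reduces everything to comparing exponents. Being the set of all monomials
  in certain variables, \<open>L(u,U)\<close> is a submonoid closed under divisors whatever the rule is, so only
  conditions (b), (c) and (d) depend on the rule (\<open>involutive_division_ofI\<close>).

  For Thomas and Janet the stronger statement holds that distinct elements of \<open>U\<close> have disjoint
  cones, which makes (b) and (c) trivial. The reason is that two distinct \<open>u, v \<in> U\<close> have different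
  degrees in some \<open>x\<^sub>i\<close> that is not multiplicative for the one of smaller degree, because that
  degree is not maximal; the cone of the smaller one is then stuck at that degree. For Thomas any
  \<open>i\<close> where the degrees differ will do, for Janet the first such \<open>i\<close>, since then \<open>u\<close> and \<open>v\<close> are in
  the same class \<open>[d\<^sub>1, \<dots>, d\<^sub>i\<^sub>-\<^sub>1]\<close>. Condition (d) holds because a degree that is maximal over a set is
  maximal over every subset.

  For Pommaret, cones can be nested. The multiplicative variables of \<open>u\<close> are those from
  its last variable on, so they can only become fewer when \<open>u\<close> is replaced by a multiple, which is (c); and
  (d) is trivial. For (b), the sets of multiplicative variables of \<open>u\<close> and \<open>v\<close> are comparable, and if
  those of \<open>v\<close> are contained in those of \<open>u\<close>, then a common element of the cones forces \<open>u\<close> and \<open>v\<close> to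
  agree before the last variable of \<open>u\<close>. Only the degree in that last variable can then prevent
  \<open>v\<close> from lying in the cone of \<open>u\<close>, and if it does, \<open>u\<close> lies in the cone of \<open>v\<close>.
\<close>

section \<open>Cones of a division given by multiplicative variables\<close>

lemma monomials_simps [simp]:
  "mult (monomials n) = (+)" "one (monomials n) = 0"
  "u \<in> carrier (monomials n) \<longleftrightarrow> vars u \<subseteq> {1..n}"
  by (simp_all add: monomials_def)

lemma vars_subset: "\<lbrakk>U \<subseteq> carrier (monomials n); u \<in> U\<rbrakk> \<Longrightarrow> vars u \<subseteq> {1..n}"
  using monomials_simps(3) by blast

lemma mem_cone_iff:
  assumes u: "vars u \<subseteq> {1..n}"
  shows "x \<in> u <#\<^bsub>monomials n\<^esub> division_of n M u U \<longleftrightarrow>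
    vars x \<subseteq> {1..n} \<and> (\<forall>i. deg i u \<le> deg i x \<and> (deg i u < deg i x \<longrightarrow> M i u U))"
    (is "?L \<longleftrightarrow> ?R")
proof
  assume ?L
  then obtain w where w: "vars w \<subseteq> {1..n}" "\<forall>i\<in>vars w. M i u U" "x = u + w"
    by (auto simp: l_coset_def division_of_def)
  have "vars x \<subseteq> {1..n}"
    using Poly_Mapping.keys_add[of u w] u w by blast
  then show ?R
    using w by (auto simp: lookup_add in_keys_iff)
next
  assume R: ?R
  have mult: "M i u U" if "i \<in> vars (x - u)" for i
    using R that by (simp add: in_keys_iff lookup_minus)
  have "vars (x - u) \<subseteq> vars x"
    by (auto simp: in_keys_iff lookup_minus)
  moreover have "x = u + (x - u)"
    using R by (intro poly_mapping_eqI) (simp add: lookup_add lookup_minus)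
  ultimately show ?L
    using R mult unfolding l_coset_def division_of_def by auto
qed

text \<open>The first two conditions hold for every rule: the monomials in a fixed set of variables form
  a submonoid, and a divisor of a monomial involves no further variables. Inclusions between sets
  of this form, as in (c) and (d), follow from inclusions between the sets of variables.\<close>

lemma involutive_division_ofI:
  assumes intersecting: "\<And>U u v x.
      \<lbrakk>finite U; U \<subseteq> carrier (monomials n); u \<in> U; v \<in> U;
       x \<in> u <#\<^bsub>monomials n\<^esub> division_of n M u U; x \<in> v <#\<^bsub>monomials n\<^esub> division_of n M v U\<rbrakk>
      \<Longrightarrow> u \<in> v <#\<^bsub>monomials n\<^esub> division_of n M v U \<or> v \<in> u <#\<^bsub>monomials n\<^esub> division_of n M u U"
    and nested: "\<And>U u v i.
      \<lbrakk>finite U; U \<subseteq> carrier (monomials n); u \<in> U; v \<in> U;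
       v \<in> u <#\<^bsub>monomials n\<^esub> division_of n M u U; i \<in> {1..n}; M i v U\<rbrakk> \<Longrightarrow> M i u U"
    and antimono: "\<And>U V u i.
      \<lbrakk>finite U; U \<subseteq> carrier (monomials n); V \<subseteq> U; u \<in> V; i \<in> {1..n}; M i u U\<rbrakk> \<Longrightarrow> M i u V"
  shows "involutive_division n (division_of n M)"
proof
  fix U u
  show "division_of n M u U \<subseteq> carrier (monomials n)"
    by (auto simp: division_of_def)
  show "\<one>\<^bsub>monomials n\<^esub> \<in> division_of n M u U"
    by (simp add: division_of_def)
  show "x \<otimes>\<^bsub>monomials n\<^esub> y \<in> division_of n M u U"
    if "x \<in> division_of n M u U" "y \<in> division_of n M u U" for x y
    using that Poly_Mapping.keys_add[of x y] by (auto simp: division_of_def)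
  show "v \<in> division_of n M u U"
    if w: "w \<in> division_of n M u U" and v: "v \<in> carrier (monomials n)"
      and dvd: "v divides\<^bsub>monomials n\<^esub> w" for v w
  proof -
    obtain c where "w = v + c"
      using dvd by (auto simp: factor_def)
    then have "vars v \<subseteq> vars w"
      by (auto simp: in_keys_iff lookup_add)
    with w v show ?thesis
      by (auto simp: division_of_def)
  qed
next
  fix U u v
  assume U: "finite U" "U \<subseteq> carrier (monomials n)" "u \<in> U" "v \<in> U"
    and "(u <#\<^bsub>monomials n\<^esub> division_of n M u U) \<inter> (v <#\<^bsub>monomials n\<^esub> division_of n M v U) \<noteq> {}"
  then show "u \<in> v <#\<^bsub>monomials n\<^esub> division_of n M v U \<or> v \<in> u <#\<^bsub>monomials n\<^esub> division_of n M u U"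
    using intersecting[OF U] by blast
next
  fix U u v
  assume U: "finite U" "U \<subseteq> carrier (monomials n)" "u \<in> U" "v \<in> U"
    and v: "v \<in> u <#\<^bsub>monomials n\<^esub> division_of n M u U"
  show "division_of n M v U \<subseteq> division_of n M u U"
    using nested[OF U v] by (auto simp: division_of_def)
next
  fix U V u
  assume U: "finite U" "U \<subseteq> carrier (monomials n)" "V \<subseteq> U" "u \<in> V"
  show "division_of n M u U \<subseteq> division_of n M u V"
    using antimono[OF U] by (auto simp: division_of_def)
qed

section \<open>Divisions with disjoint cones: Thomas and Janet\<close>

text \<open>If \<open>x\<^sub>i\<close> is not multiplicative for \<open>u\<close>, then all of \<open>u L(u,U)\<close> has the same degree in \<open>x\<^sub>i\<close> as \<open>u\<close>,
  so this cone misses all multiples of a \<open>v\<close> of larger degree. Separating any two distinct elements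
  of \<open>U\<close> in this way makes distinct cones disjoint, so that (b) and (c) have to be
  checked for \<open>u = v\<close> only.\<close>

lemma involutive_division_of_separating:
  assumes separating: "\<And>U u v.
      \<lbrakk>finite U; U \<subseteq> carrier (monomials n); u \<in> U; v \<in> U; u \<noteq> v\<rbrakk>
      \<Longrightarrow> \<exists>i. deg i u < deg i v \<and> \<not> M i u U \<or> deg i v < deg i u \<and> \<not> M i v U"
    and antimono: "\<And>U V u i.
      \<lbrakk>finite U; U \<subseteq> carrier (monomials n); V \<subseteq> U; u \<in> V; i \<in> {1..n}; M i u U\<rbrakk> \<Longrightarrow> M i u V"
  shows "involutive_division n (division_of n M)"
proof -
  have vertex: "u \<in> u <#\<^bsub>monomials n\<^esub> division_of n M u U" if "vars u \<subseteq> {1..n}" for u U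
    using that by (simp add: mem_cone_iff)
  have disjoint: "u = v"
    if U: "finite U" "U \<subseteq> carrier (monomials n)" "u \<in> U" "v \<in> U"
      and x: "x \<in> u <#\<^bsub>monomials n\<^esub> division_of n M u U" "x \<in> v <#\<^bsub>monomials n\<^esub> division_of n M v U"
    for U u v x
  proof (rule ccontr)
    assume "u \<noteq> v"
    then obtain i where
      i: "deg i u < deg i v \<and> \<not> M i u U \<or> deg i v < deg i u \<and> \<not> M i v U"
      using separating[OF U] by blast
    have vars: "vars u \<subseteq> {1..n}" "vars v \<subseteq> {1..n}"
      using U vars_subset by blast+
    have "deg i u \<le> deg i x" "deg i v \<le> deg i x"
      "deg i u < deg i x \<Longrightarrow> M i u U" "deg i v < deg i x \<Longrightarrow> M i v U"
      using x unfolding mem_cone_iff[OF vars(1)] mem_cone_iff[OF vars(2)] by blast+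
    with i show False
      by linarith
  qed
  show ?thesis
  proof (rule involutive_division_ofI)
    fix U u v x
    assume U: "finite U" "U \<subseteq> carrier (monomials n)" "u \<in> U" "v \<in> U"
      and x: "x \<in> u <#\<^bsub>monomials n\<^esub> division_of n M u U" "x \<in> v <#\<^bsub>monomials n\<^esub> division_of n M v U"
    have "u = v"
      using disjoint[OF U x] .
    then show "u \<in> v <#\<^bsub>monomials n\<^esub> division_of n M v U \<or> v \<in> u <#\<^bsub>monomials n\<^esub> division_of n M u U"
      using vertex[OF vars_subset] U by blast
  next
    fix U u v i
    assume U: "finite U" "U \<subseteq> carrier (monomials n)" "u \<in> U" "v \<in> U"
      and v: "v \<in> u <#\<^bsub>monomials n\<^esub> division_of n M u U" and "M i v U"
    have "u = v"
      using disjoint[OF U v vertex[OF vars_subset]] U by blast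
    with \<open>M i v U\<close> show "M i u U"
      by simp
  qed (fact antimono)
qed

lemma thomas_mult_iff:
  assumes "finite U" "u \<in> U"
  shows "thomas_mult i u U \<longleftrightarrow> (\<forall>v\<in>U. deg i v \<le> deg i u)"
proof -
  have "deg i ` U \<noteq> {}" "finite (deg i ` U)"
    using assms by auto
  then show ?thesis
    unfolding thomas_mult_def max_deg_def using assms(2) by (auto simp: eq_Max_iff)
qed

proposition involutive_division_thomas:
  "involutive_division n (division_of n thomas_mult)"
proof (rule involutive_division_of_separating)
  fix U and u v :: monomial
  assume U: "finite U" "u \<in> U" "v \<in> U" and "u \<noteq> v"
  then obtain i where "deg i u \<noteq> deg i v"
    by (meson poly_mapping_eqI)
  then show "\<exists>i. deg i u < deg i v \<and> \<not> thomas_mult i u U \<or> deg i v < deg i u \<and> \<not> thomas_mult i v U"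
    using U by (auto simp: thomas_mult_iff not_le neq_iff)
next
  fix U V u i
  assume U: "finite U" "V \<subseteq> U" "u \<in> V" "thomas_mult i u U"
  have "finite V" "u \<in> U"
    using U by (auto intro: rev_finite_subset)
  with U show "thomas_mult i u V"
    by (auto simp: thomas_mult_iff)
qed

text \<open>Membership in \<open>[d\<^sub>1, \<dots>, d\<^sub>i\<^sub>-\<^sub>1]\<close> determines the numbers \<open>d\<^sub>j\<close>, so the class can be described by \<open>u\<close>
  itself; for \<open>i = 1\<close> the condition on the degrees is empty and the class is all of \<open>U\<close>.\<close>

lemma janet_mult_iff:
  assumes "finite U" "u \<in> U"
  shows "janet_mult i u U \<longleftrightarrow>
    1 \<le> i \<and> (\<forall>v\<in>U. (\<forall>j\<in>{1..<i}. deg j v = deg j u) \<longrightarrow> deg i v \<le> deg i u)"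
proof -
  define C where "C = {v \<in> U. \<forall>j\<in>{1..<i}. deg j v = deg j u}"
  have "finite C" "u \<in> C"
    using assms by (auto simp: C_def)
  then have max: "deg i u = max_deg i C \<longleftrightarrow> (\<forall>v\<in>C. deg i v \<le> deg i u)"
    using thomas_mult_iff[of C u i] by (simp add: thomas_mult_def)
  have "janet_mult i u U \<longleftrightarrow> 1 \<le> i \<and> deg i u = max_deg i C"
  proof (cases "i > 1")
    case True
    then have ivl: "{1..i - 1} = {1..<i}"
      by auto
    have "janet_class U d (i - 1) = C" if "u \<in> janet_class U d (i - 1)" for d
      using that by (auto simp: janet_class_def C_def ivl)
    moreover have "u \<in> janet_class U (\<lambda>j. deg j u) (i - 1)"
      using assms by (simp add: janet_class_def)
    ultimately show ?thesis
      using True unfolding janet_mult_def by (metis less_imp_le less_irrefl)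
  next
    case False
    then have "C = U"
      by (auto simp: C_def)
    with False show ?thesis
      unfolding janet_mult_def by auto
  qed
  also have "\<dots> \<longleftrightarrow> 1 \<le> i \<and> (\<forall>v\<in>U. (\<forall>j\<in>{1..<i}. deg j v = deg j u) \<longrightarrow> deg i v \<le> deg i u)"
    unfolding max by (auto simp: C_def)
  finally show ?thesis .
qed

proposition involutive_division_janet:
  "involutive_division n (division_of n janet_mult)"
proof (rule involutive_division_of_separating)
  fix U and u v :: monomial
  assume U: "finite U" "u \<in> U" "v \<in> U" and "u \<noteq> v"
  then have differ: "\<exists>i. deg i u \<noteq> deg i v"
    by (meson poly_mapping_eqI)
  define i where "i = (LEAST i. deg i u \<noteq> deg i v)"
  have neq: "deg i u \<noteq> deg i v"
    unfolding i_def using differ by (rule LeastI_ex)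
  have same: "deg j u = deg j v" if "j < i" for j
    using that not_less_Least unfolding i_def by blast
  have "\<not> janet_mult i u U" if "deg i u < deg i v"
    using U that same by (force simp: janet_mult_iff)
  moreover have "\<not> janet_mult i v U" if "deg i v < deg i u"
    using U that same by (force simp: janet_mult_iff)
  ultimately show "\<exists>i. deg i u < deg i v \<and> \<not> janet_mult i u U \<or> deg i v < deg i u \<and> \<not> janet_mult i v U"
    using neq by (meson neq_iff)
next
  fix U V u i
  assume U: "finite U" "V \<subseteq> U" "u \<in> V" "janet_mult i u U"
  have "finite V" "u \<in> U"
    using U by (auto intro: rev_finite_subset)
  with U show "janet_mult i u V"
    by (auto simp: janet_mult_iff subset_iff)
qed

section \<open>Nested cones: Pommaret\<close>

lemma pommaret_mult_iff:
  "pommaret_mult j u U \<longleftrightarrow> (\<forall>i. 0 < deg i u \<longrightarrow> i \<le> j)"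
proof (cases "u = 0")
  case False
  then have "Max (vars u) \<le> j \<longleftrightarrow> (\<forall>i\<in>vars u. i \<le> j)"
    by (intro Max_le_iff) auto
  with False show ?thesis
    by (auto simp: pommaret_mult_def in_keys_iff)
qed (simp add: pommaret_mult_def)

text \<open>Condition (b) when \<open>v\<close> has at most the multiplicative variables of \<open>u\<close>. Let \<open>i\<close> be a
  variable that prevents \<open>v\<close> from lying in the cone of \<open>u\<close>. If it
  is non-multiplicative for \<open>u\<close>, then also for \<open>v\<close>, and both agree with \<open>x\<close> there, so it prevents
  nothing; hence the obstruction is that \<open>u\<close> has the larger degree in \<open>x\<^sub>i\<close>. Then \<open>x\<^sub>i\<close> occurs in \<open>u\<close> and is multiplicative for \<open>v\<close>, hence for \<open>u\<close>, so it is
  the last variable of \<open>u\<close>. Thus \<open>u\<close> agrees with \<open>v\<close> except at \<open>i\<close>, and lies in the cone of \<open>v\<close>.\<close>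

lemma pommaret_intersecting_cones:
  assumes uv: "vars u \<subseteq> {1..n}" "vars v \<subseteq> {1..n}"
    and x: "x \<in> u <#\<^bsub>monomials n\<^esub> division_of n pommaret_mult u U"
      "x \<in> v <#\<^bsub>monomials n\<^esub> division_of n pommaret_mult v U"
    and less: "\<And>j. pommaret_mult j v U \<Longrightarrow> pommaret_mult j u U"
  shows "u \<in> v <#\<^bsub>monomials n\<^esub> division_of n pommaret_mult v U
       \<or> v \<in> u <#\<^bsub>monomials n\<^esub> division_of n pommaret_mult u U"
proof (rule disjCI)
  assume "v \<notin> u <#\<^bsub>monomials n\<^esub> division_of n pommaret_mult u U"
  then obtain i where i: "deg i v < deg i u \<or> deg i u < deg i v \<and> \<not> pommaret_mult i u U"
    using uv by (auto simp: mem_cone_iff not_le)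
  have u_x: "deg j u \<le> deg j x" "deg j u < deg j x \<Longrightarrow> pommaret_mult j u U"
    and v_x: "deg j v \<le> deg j x" "deg j v < deg j x \<Longrightarrow> pommaret_mult j v U" for j
    using x uv by (simp_all add: mem_cone_iff)
  have lt: "deg i v < deg i u"
    using i less[of i] u_x[of i] v_x[of i] by linarith
  then have mult_i: "pommaret_mult i v U" "pommaret_mult i u U"
    using less[of i] u_x(1)[of i] v_x(2)[of i] by simp_all
  have "deg j u = deg j v" if "j \<noteq> i" for j
  proof (cases "j < i")
    case True
    have "\<not> pommaret_mult j u U"
      using lt True by (auto simp: pommaret_mult_iff not_le intro!: exI[of _ i])
    then show ?thesis
      using less[of j] u_x[of j] v_x[of j] by linarith
  next
    case False
    with that mult_i show ?thesis
      unfolding pommaret_mult_iff by (metis gr0I le_neq_implies_less)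
  qed
  then have "deg j v \<le> deg j u \<and> (deg j v < deg j u \<longrightarrow> pommaret_mult j v U)" for j
    using lt mult_i by (cases "j = i") auto
  then show "u \<in> v <#\<^bsub>monomials n\<^esub> division_of n pommaret_mult v U"
    using uv by (simp add: mem_cone_iff)
qed

proposition involutive_division_pommaret:
  "involutive_division n (division_of n pommaret_mult)"
proof (rule involutive_division_ofI)
  fix U u v x
  assume U: "U \<subseteq> carrier (monomials n)" "u \<in> U" "v \<in> U"
    and x: "x \<in> u <#\<^bsub>monomials n\<^esub> division_of n pommaret_mult u U"
      "x \<in> v <#\<^bsub>monomials n\<^esub> division_of n pommaret_mult v U"
  have uv: "vars u \<subseteq> {1..n}" "vars v \<subseteq> {1..n}"
    using U vars_subset by blast+
  \<comment> \<open>The multiplicative variables form a final segment, and final segments are totally ordered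
    by inclusion.\<close>
  have "(\<forall>j. pommaret_mult j v U \<longrightarrow> pommaret_mult j u U)
      \<or> (\<forall>j. pommaret_mult j u U \<longrightarrow> pommaret_mult j v U)"
    unfolding pommaret_mult_iff by (meson le_trans linear)
  then show "u \<in> v <#\<^bsub>monomials n\<^esub> division_of n pommaret_mult v U
      \<or> v \<in> u <#\<^bsub>monomials n\<^esub> division_of n pommaret_mult u U"
    using pommaret_intersecting_cones[OF uv x] pommaret_intersecting_cones[OF uv(2,1) x(2,1)]
    by blast
next
  fix U u v i
  assume U: "U \<subseteq> carrier (monomials n)" "u \<in> U"
    and v: "v \<in> u <#\<^bsub>monomials n\<^esub> division_of n pommaret_mult u U" and "pommaret_mult i v U"
  have "deg j u \<le> deg j v" for j
    using v mem_cone_iff[OF vars_subset[OF U]] by blast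
  with \<open>pommaret_mult i v U\<close> show "pommaret_mult i u U"
    unfolding pommaret_mult_iff by (meson less_le_trans)
next
  fix U V u i
  assume "pommaret_mult i u U"
  then show "pommaret_mult i u V"
    by (simp add: pommaret_mult_def)
qed

theorem proposition3p6:
  fixes n :: nat
  shows "involutive_division n (division_of n thomas_mult)
       \<and> involutive_division n (division_of n janet_mult)
       \<and> involutive_division n (division_of n pommaret_mult)"
  using involutive_division_thomas involutive_division_janet involutive_division_pommaret
  by blast

end
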